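(* Let $k\geq 2$ and $n\ge 1$. For every integer $m\ge 2$ let $$N_m=\frac1m\sum_{d\mid m,\ d\neq m}\mu(d)\left(2^{m/d}-2\right),$$ and let $\mathcal{D}_k$ be the set of positive divisors of $k$ other than $1$. Then the number of Grassmanian permutations $\pi\in\mathcal{S}_n$ with $\pi(1)\neq1$, $\pi(n)\neq n$ and $\pi^k=\mathrm{id}$ equals the number of solutions in non-negative integers $(x_{d,i})_{d\in\mathcal{D}_k,\,1\le i\le N_d}$ of the linear equation $$\sum_{d\in\mathcal{D}_k} d\cdot\sum_{i=1}^{N_d}x_{d,i}=n.$$ In particular, for a prime $p\ge 2$, $N_p=\frac1p(2^p-2)$, and the number of Grassmanian permutations $\pi\in\mathcal{S}_n$ with $\pi(1)\neq1$, $\pi(n)\neq n$ and $\pi^p=\mathrm{id}$ is $\binom{n/p+N_p-1}{N_p-1}$ if $p\mid n$, and $0$ otherwise.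
   Context: $\mathcal{S}_n$ is the symmetric group on $[n]=\{1,\dots,n\}$. For $\pi\in\mathcal{S}_n$, $\operatorname{des}(\pi)$ is the number of indices $i\in[n-1]$ with $\pi(i)>\pi(i+1)$; $\pi$ is Grassmanian if $\operatorname{des}(\pi)\le1$. $\mu$ is the Möbius function and $\mathrm{id}$ is the identity permutation. *)

theory Defs
  imports Complex_Main "HOL-Combinatorics.Permutations" "HOL-Computational_Algebra.Squarefree"
begin

text \<open>
  An element of the symmetric group on \<open>{1..n}\<close> is a function \<open>\<pi> :: nat \<Rightarrow> nat\<close> with
  \<open>\<pi> permutes {1..n}\<close>; it is the identity outside \<open>{1..n}\<close>, so that \<open>\<pi> ^^ k = id\<close> is
  the equation in the group.
\<close>

definition des :: "nat \<Rightarrow> (nat \<Rightarrow> nat) \<Rightarrow> nat" where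
  "des n \<pi> = card {i \<in> {1..<n}. \<pi> i > \<pi> (i + 1)}"

definition grassmannian :: "nat \<Rightarrow> (nat \<Rightarrow> nat) \<Rightarrow> bool" where
  "grassmannian n \<pi> \<longleftrightarrow> \<pi> permutes {1..n} \<and> des n \<pi> \<le> 1"

definition grassmannian_roots :: "nat \<Rightarrow> nat \<Rightarrow> (nat \<Rightarrow> nat) set" where
  "grassmannian_roots n k = {\<pi>. grassmannian n \<pi> \<and> \<pi> 1 \<noteq> 1 \<and> \<pi> n \<noteq> n \<and> \<pi> ^^ k = id}"

definition moebius :: "nat \<Rightarrow> int" where
  "moebius m = (if squarefree m then (- 1) ^ card (prime_factors m) else 0)"

text \<open>
  \<open>N m\<close> is kept rational, exactly as the formula defines it; it is used only for \<open>m \<ge> 2\<close>.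
\<close>

definition N :: "nat \<Rightarrow> rat" where
  "N m = (1 / of_nat m) * (\<Sum>d | d dvd m \<and> d \<noteq> m. of_int (moebius d) * (2 ^ (m div d) - 2))"

definition D :: "nat \<Rightarrow> nat set" where
  "D k = {d. d dvd k \<and> d \<noteq> 1}"

definition var_range :: "nat \<Rightarrow> nat set" where
  "var_range d = {i. 1 \<le> i \<and> of_nat i \<le> N d}"

text \<open>
  A family \<open>(x\<^bsub>d,i\<^esub>)\<close> is a function on pairs. The extensional function space fixes its value
  outside the index set, so that distinct functions are distinct families.
\<close>

definition solutions :: "nat \<Rightarrow> nat \<Rightarrow> (nat \<times> nat \<Rightarrow> nat) set" where
  "solutions n k = {x \<in> (SIGMA d:D k. var_range d) \<rightarrow>\<^sub>E UNIV.
     (\<Sum>d\<in>D k. d * (\<Sum>i\<in>var_range d. x (d, i))) = n}"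

end

(*
  Give each i the bit [pi i < i]. Under the hypotheses on 1 and n a Grassmannian permutation has no
  fixed point, its descent separates the excedances from the anti-excedances, and it is increasing
  on both classes. Reading the bits along the orbit of i for k steps codes i by a cyclic k-bit word.
  The codes are weakly increasing in i, and pi acts on them by cyclic rotation. Hence pi is
  determined by how often each word occurs, and every rotation-invariant multiplicity function on
  the nonconstant words arises (a binary case of the Gessel-Reutenauer correspondence). Such a
  function assigns a number to each rotation orbit. By Moebius inversion there are N d orbits of
  size d, because 2^d - 2 nonconstant words are fixed by the d-th power of the rotation.
*)

theory Submission
  imports Defs "HOL-Combinatorics.Cycles"
begin

section \<open>Moebius inversion\<close>

text \<open>Only squarefree divisors contribute. Multiplication by a fixed prime \<open>p\<close>
  dividing \<open>m\<close> pairs those prime to \<open>p\<close> with those divisible by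
  \<open>p\<close> and flips the sign of \<open>moebius\<close>.\<close>

lemma sum_moebius_divisors:
  assumes "m > 1"
  shows "(\<Sum>d | d dvd m. moebius d) = 0"
proof -
  obtain p where p: "prime p" "p dvd m"
    using assms prime_factor_nat[of m] by auto
  define S where "S = {d. d dvd m \<and> squarefree d}"
  define A where "A = {d\<in>S. \<not> p dvd d}"
  define B where "B = {d\<in>S. p dvd d}"
  have fin: "finite {d. d dvd m}"
    using assms by simp
  have finS: "finite S"
    by (rule finite_subset[OF _ fin]) (auto simp: S_def)
  have "bij_betw (\<lambda>d. p * d) A B"
  proof (rule bij_betwI')
    fix x y assume "x \<in> A" "y \<in> A"
    show "p * x = p * y \<longleftrightarrow> x = y" using p by auto
  next
    fix d assume d: "d \<in> A"
    then have "coprime p d" using p by (auto simp: A_def intro: prime_imp_coprime)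
    with d p show "p * d \<in> B"
      by (auto simp: A_def B_def S_def intro: divides_mult squarefree_mult_coprime squarefree_prime)
  next
    fix e assume e: "e \<in> B"
    then obtain d where d: "e = p * d" by (auto simp: B_def)
    have "\<not> p dvd d"
    proof
      assume "p dvd d"
      then have "p\<^sup>2 dvd e" by (auto simp: d power2_eq_square)
      moreover have "squarefree e" using e by (simp add: B_def S_def)
      ultimately show False using p(1) by (auto dest: squarefreeD)
    qed
    moreover have "d dvd m" "squarefree d"
      using e squarefree_multD(2)[of p d] dvd_mult_right[of p d m] by (auto simp: B_def S_def d)
    ultimately have "d \<in> A" by (simp add: A_def S_def)
    then show "\<exists>x\<in>A. e = p * x" using d by blast
  qed
  then have "(\<Sum>d\<in>B. moebius d) = (\<Sum>d\<in>A. moebius (p * d))"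
    by (rule sum.reindex_bij_betw[symmetric])
  also have "\<dots> = (\<Sum>d\<in>A. - moebius d)"
  proof (rule sum.cong)
    fix d assume d: "d \<in> A"
    have "squarefree d" "\<not> p dvd d" using d by (auto simp: A_def S_def)
    moreover have "d \<noteq> 0" using calculation by (intro notI) simp
    moreover have "coprime p d"
      using p(1) calculation(2) by (rule prime_imp_coprime)
    moreover have "prime_factors (p * d) = insert p (prime_factors d)"
      using \<open>d \<noteq> 0\<close> p by (auto simp: prime_factors_product prime_prime_factors)
    moreover have "p \<notin> prime_factors d" using calculation(2) by auto
    ultimately show "moebius (p * d) = - moebius d"
      using p(1) by (simp add: moebius_def squarefree_mult_coprime squarefree_prime)
  qed simp
  finally have "(\<Sum>d\<in>A. moebius d) + (\<Sum>d\<in>B. moebius d) = 0"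
    by (simp add: sum_negf)
  moreover have "(\<Sum>d | d dvd m. moebius d) = (\<Sum>d\<in>S. moebius d)"
    by (rule sum.mono_neutral_right[OF fin]) (auto simp: S_def moebius_def)
  moreover have "(\<Sum>d\<in>S. moebius d) = (\<Sum>d\<in>A. moebius d) + (\<Sum>d\<in>B. moebius d)"
  proof -
    have "S = A \<union> B" by (auto simp: A_def B_def)
    moreover have "finite A" "finite B" "A \<inter> B = {}"
      using finS by (auto simp: A_def B_def)
    ultimately show ?thesis using sum.union_disjoint by metis
  qed
  ultimately show ?thesis by simp
qed

text \<open>The relation between \<open>f\<close> and \<open>g\<close> is assumed only at divisors
  of \<open>m\<close>, since the orbit counts are available only at divisors of \<open>k\<close>.
  After swapping the double sum, the inner sum over \<open>moebius\<close> vanishes unless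
  \<open>e = m\<close>.\<close>

lemma moebius_inversion:
  fixes f g :: "nat \<Rightarrow> 'a::comm_ring_1"
  assumes "m > 0" and g: "\<And>d. d dvd m \<Longrightarrow> g d = (\<Sum>e | e dvd d. f e)"
  shows "f m = (\<Sum>d | d dvd m. of_int (moebius d) * g (m div d))"
proof -
  let ?S = "{d. d dvd m}"
  have fin: "finite ?S" using assms by simp
  have dvd_div: "e dvd m div d \<longleftrightarrow> d * e dvd m" if "d dvd m" for d e
    using that assms by (auto elim!: dvdE)
  have "(\<Sum>d\<in>?S. of_int (moebius d) * g (m div d))
      = (\<Sum>d\<in>?S. \<Sum>e\<in>{e. e \<in> ?S \<and> d * e dvd m}. of_int (moebius d) * f e)"
  proof (rule sum.cong)
    fix d assume "d \<in> ?S"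
    then have d: "d dvd m" by simp
    have "g (m div d) = (\<Sum>e | e dvd m div d. f e)"
      by (rule g) (use d in \<open>auto elim!: dvdE\<close>)
    also have "{e. e dvd m div d} = {e. e \<in> ?S \<and> d * e dvd m}"
      using dvd_div[OF d] by (auto dest: dvd_mult_right)
    finally show "of_int (moebius d) * g (m div d)
        = (\<Sum>e\<in>{e. e \<in> ?S \<and> d * e dvd m}. of_int (moebius d) * f e)"
      by (simp add: sum_distrib_left)
  qed simp
  also have "\<dots> = (\<Sum>e\<in>?S. \<Sum>d\<in>{d. d \<in> ?S \<and> d * e dvd m}. of_int (moebius d) * f e)"
    by (rule sum.swap_restrict[OF fin fin])
  also have "\<dots> = (\<Sum>e\<in>?S. if e = m then f m else 0)"
  proof (rule sum.cong)
    fix e assume "e \<in> ?S"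
    then have e: "e dvd m" by simp
    then have "e > 0" using assms(1) by (auto intro: Nat.gr0I)
    have "{d. d \<in> ?S \<and> d * e dvd m} = {d. d dvd m div e}"
      using dvd_div[OF e] by (auto simp: mult.commute dest: dvd_mult_right)
    then have "(\<Sum>d\<in>{d. d \<in> ?S \<and> d * e dvd m}. of_int (moebius d) * f e)
        = of_int (\<Sum>d | d dvd m div e. moebius d) * f e"
      by (simp add: sum_distrib_right)
    also have "(\<Sum>d | d dvd m div e. moebius d) = (if e = m then 1 else 0)"
    proof (cases "e = m")
      case True
      then have "m div e = 1" using assms(1) by simp
      moreover have "moebius 1 = 1" by (simp add: moebius_def)
      ultimately show ?thesis using True by simp
    next
      case False
      obtain c where "m = e * c" using e by auto
      then have "m div e > 1" using False assms(1) by (cases c; cases "c - 1") auto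
      then show ?thesis using False sum_moebius_divisors by simp
    qed
    finally show "(\<Sum>d\<in>{d. d \<in> ?S \<and> d * e dvd m}. of_int (moebius d) * f e)
        = (if e = m then f m else 0)" by simp
  qed simp
  also have "\<dots> = f m" using fin by simp
  finally show ?thesis by simp
qed

text \<open>The term \<open>d = m\<close> left out in \<open>N\<close> carries the factor
  \<open>2 ^ 1 - 2 = 0\<close>, so it may be added to obtain the sum produced by Moebius
  inversion.\<close>

lemma N_eq_moebius_sum:
  "of_nat m * N m = (\<Sum>d | d dvd m. of_int (moebius d) * (2 ^ (m div d) - 2))"
  if "m > 0"
proof -
  have "{d. d dvd m} = insert m {d. d dvd m \<and> d \<noteq> m}" by auto
  moreover have "finite {d. d dvd m \<and> d \<noteq> m}"
    by (rule finite_subset[of _ "{d. d dvd m}"]) (use that in auto)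
  ultimately show ?thesis using that by (simp add: N_def)
qed

lemma N_prime:
  assumes "prime p"
  shows "N p = (1 / of_nat p) * (2 ^ p - 2)"
proof -
  have "{d. d dvd p \<and> d \<noteq> p} = {1}"
    using assms by (auto simp: prime_nat_iff)
  then show ?thesis by (simp add: N_def moebius_def)
qed

section \<open>Rotation of binary words\<close>

text \<open>
  A \<open>k\<close>-bit word is the number it denotes in binary, most significant bit first; the constant words
  \<open>0\<close> and \<open>2 ^ k - 1\<close> are left out. Cyclic rotation to the left is then doubling modulo \<open>2 ^ k - 1\<close>.
\<close>

definition words :: "nat \<Rightarrow> nat set" where
  "words k = {1..<2 ^ k - 1}"

definition rot :: "nat \<Rightarrow> nat \<Rightarrow> nat" where
  "rot k u = (if u < 2 ^ (k - 1) then 2 * u else 2 * u - (2 ^ k - 1))"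

lemma finite_words [simp]: "finite (words k)"
  by (simp add: words_def)

lemma words_pos: "u \<in> words k \<Longrightarrow> 0 < u"
  by (simp add: words_def)

lemma words_imp_pow: "u \<in> words k \<Longrightarrow> k > 0 \<and> (2::nat) ^ k = 2 * 2 ^ (k - 1)"
  by (cases k) (simp_all add: words_def)

text \<open>With the half \<open>h\<close> named, the facts about a single rotation become linear
  arithmetic.\<close>

lemma wordsE:
  assumes "u \<in> words k"
  obtains h where "(2::nat) ^ k = 2 * h" "(2::nat) ^ (k - 1) = h" "0 < u" "u < 2 * h - 1"
  using assms words_imp_pow[OF assms] by (auto simp: words_def)

lemma rot_words: "u \<in> words k \<Longrightarrow> rot k u \<in> words k"
  by (erule wordsE) (auto simp: words_def rot_def)

lemma rot_less_iff: "u \<in> words k \<Longrightarrow> rot k u < u \<longleftrightarrow> 2 ^ (k - 1) \<le> u"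
  by (erule wordsE) (auto simp: rot_def)

lemma rot_neq: "u \<in> words k \<Longrightarrow> rot k u \<noteq> u"
  by (erule wordsE) (auto simp: rot_def)

text \<open>Words with the same leading bit are reduced by the same amount after doubling. This
  mirrors a permutation that is increasing on each of its two classes.\<close>

lemma rot_strict_mono:
  assumes "u \<in> words k" "w \<in> words k" "u < w" "u < 2 ^ (k - 1) \<longleftrightarrow> w < 2 ^ (k - 1)"
  shows "rot k u < rot k w"
  using assms(1,3,4) by (elim wordsE) (auto simp: rot_def)

lemma int_rot:
  assumes "u \<in> words k"
  shows "int (rot k u) = 2 * int u - of_bool (2 ^ (k - 1) \<le> u) * (2 ^ k - 1)"
proof (cases "2 ^ (k - 1) \<le> u")
  case True
  moreover have "1 \<le> (2::nat) ^ k" by simp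
  moreover have "2 ^ k - 1 \<le> 2 * u"
    using True words_imp_pow[OF assms] by linarith
  ultimately show ?thesis by (simp add: rot_def of_nat_diff)
qed (simp add: rot_def)

lemma funpow_rot_words: "u \<in> words k \<Longrightarrow> (rot k ^^ j) u \<in> words k"
  by (induction j) (auto intro: rot_words)

lemma funpow_rot_cong:
  assumes "u \<in> words k"
  shows "(2 ^ k - 1) dvd int ((rot k ^^ j) u) - 2 ^ j * int u"
proof (induction j)
  case (Suc j)
  let ?w = "(rot k ^^ j) u"
  have "int ((rot k ^^ Suc j) u) - 2 ^ Suc j * int u
      = 2 * (int ?w - 2 ^ j * int u) - of_bool (2 ^ (k - 1) \<le> ?w) * (2 ^ k - 1)"
    using int_rot[OF funpow_rot_words[OF assms]] by (simp add: algebra_simps)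
  then show ?case using Suc by (simp only: dvd_diff dvd_mult dvd_triv_right)
qed simp

text \<open>Rotating \<open>j\<close> times multiplies by \<open>2 ^ j\<close> modulo
  \<open>2 ^ k - 1\<close>. Words lie strictly between 0 and this modulus, so congruent words are
  equal.\<close>

lemma funpow_rot_fixed_iff:
  assumes "u \<in> words k"
  shows "(rot k ^^ j) u = u \<longleftrightarrow> (2 ^ k - 1) dvd (2 ^ j - 1) * int u"
proof -
  let ?w = "(rot k ^^ j) u"
  define M :: int where "M = 2 ^ k - 1"
  have lt: "int x < M" if "x \<in> words k" for x
  proof -
    have "int (x + 1) < int (2 ^ k)"
      using that by (subst of_nat_less_iff) (auto simp: words_def)
    then show ?thesis by (simp add: M_def)
  qed
  have "M dvd int ?w - 2 ^ j * int u"
    unfolding M_def by (rule funpow_rot_cong[OF assms])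
  moreover have "int ?w - int u = (int ?w - 2 ^ j * int u) + (2 ^ j - 1) * int u"
    by (simp add: algebra_simps)
  ultimately have "M dvd (2 ^ j - 1) * int u \<longleftrightarrow> M dvd int ?w - int u"
    by (simp only: dvd_add_right_iff)
  also have "\<dots> \<longleftrightarrow> ?w = u"
  proof
    assume dvd: "M dvd int ?w - int u"
    have "\<bar>int ?w - int u\<bar> < M"
      using lt[OF assms] lt[OF funpow_rot_words[OF assms, of j]] by linarith
    with dvd have "int ?w - int u = 0"
      using dvd_imp_le_int[of "int ?w - int u" M] by (cases "int ?w - int u = 0") auto
    then show "?w = u" by simp
  qed simp
  finally show ?thesis by (simp add: M_def)
qed

lemma funpow_rot_period: "u \<in> words k \<Longrightarrow> (rot k ^^ k) u = u"
  by (simp add: funpow_rot_fixed_iff)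

lemma inj_on_rot: "inj_on (rot k) (words k)"
proof (rule inj_onI)
  fix u w assume uw: "u \<in> words k" "w \<in> words k" and eq: "rot k u = rot k w"
  from words_imp_pow[OF uw(1)] have "k = Suc (k - 1)" by simp
  then have "(rot k ^^ k) x = (rot k ^^ (k - 1)) (rot k x)" for x
    by (metis funpow_Suc_right o_apply)
  then show "u = w" using eq uw by (metis funpow_rot_period)
qed

text \<open>Write \<open>2 ^ k - 1 = (2 ^ d - 1) * q\<close>. The fixed words are the multiples of
  \<open>q\<close>: the product \<open>q * t\<close> repeats the \<open>d\<close>-bit word
  \<open>t\<close>, and \<open>t\<close> ranges over the nonconstant ones.\<close>

lemma card_fixed_rot:
  assumes "d dvd k" "k > 0"
  shows "card {u \<in> words k. (rot k ^^ d) u = u} = 2 ^ d - 2"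
proof -
  have "d > 0" using assms by (auto intro: Nat.gr0I)
  obtain c where c: "k = d * c" using assms by auto
  have "(2::int) ^ d - 1 dvd 2 ^ k - 1"
    using power_diff_1_eq[of "(2::int) ^ d" c] by (simp add: c power_mult)
  then obtain q' :: int where q': "2 ^ k - 1 = (2 ^ d - 1) * q'" by auto
  have pos: "(2::int) ^ d - 1 > 0" "(2::int) ^ k - 1 > 0" using \<open>d > 0\<close> assms(2) by auto
  then have "q' > 0" using q' by (simp add: zero_less_mult_iff)
  then obtain q where q: "q' = int q" "q > 0" by (metis zero_less_imp_eq_int)
  have "int (2 ^ k - 1) = int ((2 ^ d - 1) * q)"
    using q' q by (simp add: of_nat_diff)
  then have qn: "2 ^ k - 1 = (2 ^ d - 1) * q" by (simp only: of_nat_eq_iff)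
  have "(rot k ^^ d) u = u \<longleftrightarrow> q dvd u" if "u \<in> words k" for u
    using pos \<open>d > 0\<close> by (simp add: funpow_rot_fixed_iff[OF that] q' q)
  then have "{u \<in> words k. (rot k ^^ d) u = u} = {u \<in> words k. q dvd u}" by auto
  also have "{u \<in> words k. q dvd u} = (\<lambda>t. q * t) ` {1..<2 ^ d - 1}"
  proof -
    have "{u \<in> {1..<m * q}. q dvd u} = (\<lambda>t. q * t) ` {1..<m}" for m
      using q(2) by (auto simp: mult.commute elim!: dvdE)
    then show ?thesis by (simp only: words_def qn)
  qed
  also have "card \<dots> = 2 ^ d - 2"
    using q(2) by (subst card_image) (auto intro: inj_onI)
  finally show ?thesis .
qed

section \<open>Codes of the points of a permutation\<close>

text \<open>The first step gets the most significant bit, so numerical order of codes is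
  lexicographic order of the up-down patterns.\<close>

definition code :: "nat \<Rightarrow> (nat \<Rightarrow> nat) \<Rightarrow> nat \<Rightarrow> nat" where
  "code k \<pi> i = (\<Sum>j<k. of_bool ((\<pi> ^^ Suc j) i < (\<pi> ^^ j) i) * 2 ^ (k - 1 - j))"

text \<open>Passing from \<open>i\<close> to \<open>\<pi> i\<close> moves the leading bit to the
  end. The equation is additive to avoid truncated subtraction.\<close>

lemma code_step:
  assumes "(\<pi> ^^ k) i = i" "k > 0"
  shows "code k \<pi> (\<pi> i) + of_bool (\<pi> i < i) * (2 ^ k - 1) = 2 * code k \<pi> i"
proof -
  \<comment> \<open>The index runs one place further than in \<open>code\<close>: \<open>f 0\<close>
    is the leading bit with weight \<open>2 ^ k\<close>, and \<open>f k\<close> is the same bit back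
    at weight 1 after a full period.\<close>
  define f where "f j = of_bool ((\<pi> ^^ Suc j) i < (\<pi> ^^ j) i) * (2::nat) ^ (k - j)" for j
  have "2 * code k \<pi> i = (\<Sum>j<k. f j)"
    unfolding code_def sum_distrib_left
  proof (rule sum.cong)
    fix j assume "j \<in> {..<k}"
    then have "k - j = Suc (k - 1 - j)" by simp
    then show "2 * (of_bool ((\<pi> ^^ Suc j) i < (\<pi> ^^ j) i) * 2 ^ (k - 1 - j)) = f j"
      by (simp add: f_def)
  qed simp
  moreover have "code k \<pi> (\<pi> i) = (\<Sum>j<k. f (Suc j))"
    by (simp add: code_def f_def funpow_swap1)
  moreover have "f 0 + (\<Sum>j<k. f (Suc j)) = (\<Sum>j<k. f j) + f k"
    by (metis sum.lessThan_Suc sum.lessThan_Suc_shift)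
  moreover have "f 0 = of_bool (\<pi> i < i) * (2 ^ k - 1) + f k"
    using assms by (simp add: f_def)
  ultimately show ?thesis by linarith
qed

lemma code_less: "code k \<pi> i < 2 ^ k"
proof -
  have "code k \<pi> i \<le> (\<Sum>j<k. 2 ^ (k - 1 - j))"
    unfolding code_def by (rule sum_mono) simp
  also have "\<dots> = (\<Sum>j<k. 2 ^ j)"
    using sum.nat_diff_reindex[of "\<lambda>j. (2::nat) ^ j" k] by simp
  also have "\<dots> < 2 ^ k"
    by (induction k) auto
  finally show ?thesis .
qed

lemma code_ge:
  assumes "k > 0" "\<pi> i < i"
  shows "2 ^ (k - 1) \<le> code k \<pi> i"
proof -
  have "of_bool ((\<pi> ^^ Suc 0) i < (\<pi> ^^ 0) i) * 2 ^ (k - 1 - 0) \<le> code k \<pi> i"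
    unfolding code_def by (rule member_le_sum) (use assms in auto)
  then show ?thesis using assms by simp
qed

text \<open>The coding argument works from these order conditions instead of the descent count;
  \<open>grassmannian_roots_imp_perm_root\<close> derives them from the position of the
  descent.\<close>

locale perm_root =
  fixes n k :: nat and \<pi> :: "nat \<Rightarrow> nat"
  assumes k_pos: "k > 0"
    and perm: "\<pi> permutes {1..n}"
    and root: "\<pi> ^^ k = id"
    and no_fix: "i \<in> {1..n} \<Longrightarrow> \<pi> i \<noteq> i"
    and exc_mono: "i \<in> {1..n} \<Longrightarrow> j \<in> {1..n} \<Longrightarrow> i < j \<Longrightarrow> \<pi> i < i \<Longrightarrow> \<pi> j < j"
    and less: "i \<in> {1..n} \<Longrightarrow> j \<in> {1..n} \<Longrightarrow> i < j \<Longrightarrow> \<pi> i < i \<longleftrightarrow> \<pi> j < j \<Longrightarrow> \<pi> i < \<pi> j"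
begin

lemma in_range: "i \<in> {1..n} \<Longrightarrow> \<pi> i \<in> {1..n}"
  using permutes_in_image[OF perm] by simp

lemma funpow_in_range: "i \<in> {1..n} \<Longrightarrow> (\<pi> ^^ t) i \<in> {1..n}"
  by (induction t) (use in_range in auto)

lemma step: "code k \<pi> (\<pi> i) + of_bool (\<pi> i < i) * (2 ^ k - 1) = 2 * code k \<pi> i"
  by (rule code_step) (simp_all add: root k_pos)

lemma two_pow: "(2::nat) ^ k = 2 * 2 ^ (k - 1)"
  using k_pos by (cases k) auto

text \<open>If \<open>\<pi>\<close> does not drop at \<open>i\<close>, the code of
  \<open>\<pi> i\<close> is twice that of \<open>i\<close>; a leading bit 1 would then push it to
  \<open>2 ^ k\<close> or more.\<close>

lemma code_ge_iff: "2 ^ (k - 1) \<le> code k \<pi> i \<longleftrightarrow> \<pi> i < i"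
proof
  assume *: "2 ^ (k - 1) \<le> code k \<pi> i"
  show "\<pi> i < i"
  proof (rule ccontr)
    assume "\<not> \<pi> i < i"
    then show False using step[of i] * two_pow code_less[of k \<pi> "\<pi> i"] by simp
  qed
qed (rule code_ge[OF k_pos])

text \<open>A zero code would make \<open>\<pi>\<close> climb at every step of an orbit that closes
  after \<open>k\<close> steps.\<close>

lemma code_nonzero:
  assumes i: "i \<in> {1..n}"
  shows "code k \<pi> i \<noteq> 0"
proof
  assume 0: "code k \<pi> i = 0"
  have "code k \<pi> ((\<pi> ^^ t) i) = 0 \<and> i + t \<le> (\<pi> ^^ t) i" for t
  proof (induction t)
    case (Suc t)
    let ?x = "(\<pi> ^^ t) i"
    have "\<not> \<pi> ?x < ?x" using code_ge_iff[of ?x] Suc by auto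
    then show ?case using Suc step[of ?x] no_fix[OF funpow_in_range[OF i, of t]] by auto
  qed (use 0 in simp)
  from this[of k] show False using k_pos by (simp add: root)
qed

text \<open>Dually, a code of ones only would force a descent at every step of a closed
  orbit.\<close>

lemma code_less_max:
  assumes i: "i \<in> {1..n}"
  shows "code k \<pi> i < 2 ^ k - 1"
proof (rule ccontr)
  assume "\<not> code k \<pi> i < 2 ^ k - 1"
  then have top: "code k \<pi> i = 2 ^ k - 1" using code_less[of k \<pi> i] by linarith
  have "code k \<pi> ((\<pi> ^^ t) i) = 2 ^ k - 1 \<and> (\<pi> ^^ t) i + t \<le> i" for t
  proof (induction t)
    case (Suc t)
    let ?x = "(\<pi> ^^ t) i"
    have "(2::nat) ^ (k - 1) \<ge> 1" by simp
    then have "2 ^ (k - 1) \<le> code k \<pi> ?x" using Suc two_pow by linarith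
    then have "\<pi> ?x < ?x" using code_ge_iff by blast
    moreover from this have "code k \<pi> (\<pi> ?x) + (2 ^ k - 1) = 2 * code k \<pi> ?x"
      using step[of ?x] by simp
    ultimately have "code k \<pi> (\<pi> ?x) = 2 ^ k - 1 \<and> \<pi> ?x + Suc t \<le> i"
      using Suc by linarith
    then show ?case by simp
  qed (use top in simp)
  from this[of k] show False using k_pos by (simp add: root)
qed

lemma code_words: "i \<in> {1..n} \<Longrightarrow> code k \<pi> i \<in> words k"
  using code_nonzero[of i] code_less_max[of i] by (simp add: words_def)

lemma code_rot:
  assumes "i \<in> {1..n}"
  shows "code k \<pi> (\<pi> i) = rot k (code k \<pi> i)"
proof (cases "\<pi> i < i")
  case True
  then have "code k \<pi> (\<pi> i) + (2 ^ k - 1) = 2 * code k \<pi> i" using step[of i] by simp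
  then have "code k \<pi> (\<pi> i) = 2 * code k \<pi> i - (2 ^ k - 1)" by linarith
  then show ?thesis using True code_ge_iff[of i] by (simp add: rot_def)
qed (use step[of i] code_ge_iff[of i] in \<open>simp add: rot_def\<close>)

lemma code_mono:
  assumes "i \<in> {1..n}" "j \<in> {1..n}" "i \<le> j"
  shows "code k \<pi> i \<le> code k \<pi> j"
proof (rule ccontr)
  assume "\<not> code k \<pi> i \<le> code k \<pi> j"
  \<comment> \<open>The gap between the codes doubles along the orbits, while the codes stay bounded.\<close>
  then have "(\<pi> ^^ t) i < (\<pi> ^^ t) j \<and> code k \<pi> ((\<pi> ^^ t) j) + t < code k \<pi> ((\<pi> ^^ t) i)" for t
  proof (induction t)
    case 0
    then show ?case using assms(3) by (cases "i = j") auto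
  next
    case (Suc t)
    let ?x = "(\<pi> ^^ t) i" and ?y = "(\<pi> ^^ t) j"
    have IH: "?x < ?y" "code k \<pi> ?y + t < code k \<pi> ?x" using Suc by auto
    have xy: "?x \<in> {1..n}" "?y \<in> {1..n}" using assms funpow_in_range by auto
    \<comment> \<open>One direction is \<open>exc_mono\<close>. For the other, a leading bit 1 at
      \<open>?y\<close> forces one at \<open>?x\<close>, whose code is larger.\<close>
    have same: "\<pi> ?x < ?x \<longleftrightarrow> \<pi> ?y < ?y"
      using exc_mono[OF xy IH(1)] code_ge_iff[of ?x] code_ge_iff[of ?y] IH(2) by linarith
    then have "\<pi> ?x < \<pi> ?y" using less[OF xy IH(1)] by blast
    moreover have "code k \<pi> (\<pi> ?y) + Suc t < code k \<pi> (\<pi> ?x)"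
      using step[of ?x] step[of ?y] IH(2) same by (cases "\<pi> ?y < ?y") auto
    ultimately show ?case by simp
  qed
  from this[of "2 ^ k"] show False using code_less[of k \<pi> "(\<pi> ^^ (2 ^ k)) i"] by simp
qed

lemma less_of_code_eq:
  assumes "i \<in> {1..n}" "j \<in> {1..n}" "i < j" "code k \<pi> i = code k \<pi> j"
  shows "\<pi> i < \<pi> j"
  using assms less code_ge_iff by metis

end

text \<open>On either side of its descent \<open>\<pi>\<close> has slope at least 1. Hence
  \<open>\<pi> 1 > 1\<close> lifts the whole left block above the diagonal, and
  \<open>\<pi> n < n\<close> presses the right block below it.\<close>

lemma grassmannian_roots_imp_perm_root:
  assumes "\<pi> \<in> grassmannian_roots n k" "k > 0"
  shows "perm_root n k \<pi>"
proof -
  from assms have perm: "\<pi> permutes {1..n}" and des: "des n \<pi> \<le> 1"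
    and ends: "\<pi> 1 \<noteq> 1" "\<pi> n \<noteq> n" and root: "\<pi> ^^ k = id"
    by (auto simp: grassmannian_roots_def grassmannian_def)
  have range: "\<pi> i \<in> {1..n} \<longleftrightarrow> i \<in> {1..n}" for i
    using permutes_in_image[OF perm] .
  have inj: "\<pi> i = \<pi> j \<longleftrightarrow> i = j" for i j
    using permutes_inj[OF perm] by (auto dest: injD)
  \<comment> \<open>\<open>a\<close> is the position of the descent, and arbitrary if there is
    none.\<close>
  obtain a where "{i \<in> {1..<n}. \<pi> i > \<pi> (i + 1)} \<subseteq> {a}"
  proof -
    have "finite {i \<in> {1..<n}. \<pi> i > \<pi> (i + 1)}" by simp
    then have "\<exists>a. {i \<in> {1..<n}. \<pi> i > \<pi> (i + 1)} \<subseteq> {a}"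
      using des unfolding des_def by (cases "{i \<in> {1..<n}. \<pi> i > \<pi> (i + 1)} = {}") (auto simp: card_le_Suc0_iff_eq)
    then show ?thesis using that by blast
  qed
  then have asc: "\<pi> i < \<pi> (Suc i)" if "1 \<le> i" "i < n" "i \<noteq> a" for i
    using that inj[of i "Suc i"] by fastforce
  have gap: "\<pi> i + (j - i) \<le> \<pi> j" if "1 \<le> i" "i \<le> j" "j \<le> n" "j \<le> a \<or> a < i" for i j
    using that(2,3,4)
  proof (induction j rule: dec_induct)
    case (step j)
    then show ?case using asc[of j] that(1) by (auto simp: Suc_diff_le)
  qed simp
  have up: "i < \<pi> i" if "i \<in> {1..n}" "i \<le> a" for i
    using gap[of 1 i] that ends(1) range[of 1] by fastforce
  have down: "\<pi> i < i" if "i \<in> {1..n}" "a < i" for i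
    using gap[of i n] that ends(2) range[of n] by fastforce
  have iff: "\<pi> i < i \<longleftrightarrow> a < i" if "i \<in> {1..n}" for i
    using up[OF that] down[OF that] by linarith
  show ?thesis
  proof
    show "\<pi> i \<noteq> i" if "i \<in> {1..n}" for i
      using up[OF that] down[OF that] by fastforce
    show "\<pi> j < j" if "i \<in> {1..n}" "j \<in> {1..n}" "i < j" "\<pi> i < i" for i j
      using that(3,4) iff[OF that(1)] iff[OF that(2)] by linarith
    show "\<pi> i < \<pi> j" if "i \<in> {1..n}" "j \<in> {1..n}" "i < j" "\<pi> i < i \<longleftrightarrow> \<pi> j < j" for i j
      using gap[of i j] that(3,4) iff[OF that(1)] iff[OF that(2)] that(1,2) by auto
  qed (use assms perm root in auto)
qed

section \<open>Permutations and rotation-invariant multiplicities\<close>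

definition invariants :: "nat \<Rightarrow> nat \<Rightarrow> (nat \<Rightarrow> nat) set" where
  "invariants n k = {m \<in> words k \<rightarrow>\<^sub>E UNIV.
     (\<forall>u\<in>words k. m (rot k u) = m u) \<and> (\<Sum>u\<in>words k. m u) = n}"

definition fibres :: "nat \<Rightarrow> nat \<Rightarrow> (nat \<Rightarrow> nat) \<Rightarrow> nat \<Rightarrow> nat" where
  "fibres n k \<pi> = restrict (\<lambda>u. card {i \<in> {1..n}. code k \<pi> i = u}) (words k)"

text \<open>In the sorted sequence of words, \<open>u\<close> occupies the positions from
  \<open>cum m u + 1\<close> to \<open>cum m u + m u\<close>. The sum starts at 1 because 0 is not a
  word.\<close>

definition cum :: "(nat \<Rightarrow> nat) \<Rightarrow> nat \<Rightarrow> nat" where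
  "cum m u = (\<Sum>w\<in>{1..<u}. m w)"

text \<open>
  \<open>level m i\<close> is the \<open>i\<close>-th entry of the weakly increasing sequence that contains each word \<open>u\<close>
  exactly \<open>m u\<close> times.
\<close>

definition level :: "(nat \<Rightarrow> nat) \<Rightarrow> nat \<Rightarrow> nat" where
  "level m i = (LEAST u. i \<le> cum m (Suc u))"

text \<open>
  The \<open>j\<close>-th point at level \<open>u\<close> goes to the \<open>j\<close>-th point at level \<open>rot k u\<close>.
\<close>

definition unfibre :: "nat \<Rightarrow> nat \<Rightarrow> (nat \<Rightarrow> nat) \<Rightarrow> nat \<Rightarrow> nat" where
  "unfibre n k m i =
     (if i \<in> {1..n} then cum m (rot k (level m i)) + (i - cum m (level m i)) else i)"

lemma cum_mono: "u \<le> w \<Longrightarrow> cum m u \<le> cum m w"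
  unfolding cum_def by (rule sum_mono2) auto

lemma cum_Suc: "u > 0 \<Longrightarrow> cum m (Suc u) = cum m u + m u"
  by (simp add: cum_def)

lemma level_eqI:
  assumes "cum m u < i" "i \<le> cum m (Suc u)"
  shows "level m i = u"
  unfolding level_def
proof (rule Least_equality)
  fix y assume "i \<le> cum m (Suc y)"
  then show "u \<le> y" using cum_mono[of "Suc y" u m] assms by (cases "u \<le> y") auto
qed (rule assms)

section \<open>From a permutation to its multiplicities, and injectivity\<close>

context perm_root
begin

text \<open>The bound on \<open>u\<close> keeps the sum within \<open>words k\<close>, outside of
  which \<open>fibres\<close> is unspecified.\<close>

lemma cum_fibres:
  assumes "u \<le> 2 ^ k - 1"
  shows "cum (fibres n k \<pi>) u = card {i \<in> {1..n}. code k \<pi> i < u}"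
proof -
  have "cum (fibres n k \<pi>) u = (\<Sum>w\<in>{1..<u}. card {i \<in> {1..n}. code k \<pi> i = w})"
    unfolding cum_def by (rule sum.cong) (use assms in \<open>auto simp: fibres_def words_def\<close>)
  also have "\<dots> = card (\<Union>w\<in>{1..<u}. {i \<in> {1..n}. code k \<pi> i = w})"
    by (rule card_UN_disjoint[symmetric]) auto
  also have "(\<Union>w\<in>{1..<u}. {i \<in> {1..n}. code k \<pi> i = w}) = {i \<in> {1..n}. code k \<pi> i < u}"
    using code_nonzero by fastforce
  finally show ?thesis .
qed

text \<open>By \<open>code_mono\<close> the points up to \<open>i\<close> are those of smaller code
  and those of equal code not beyond \<open>i\<close>. A point is thus recovered from its code and
  its rank among the points sharing it.\<close>

lemma cum_fibres_rank:
  assumes i: "i \<in> {1..n}"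
  shows "i = cum (fibres n k \<pi>) (code k \<pi> i) + card {j \<in> {1..n}. code k \<pi> j = code k \<pi> i \<and> j \<le> i}"
proof -
  let ?A = "{j \<in> {1..n}. code k \<pi> j < code k \<pi> i}"
  let ?B = "{j \<in> {1..n}. code k \<pi> j = code k \<pi> i \<and> j \<le> i}"
  have "?A \<union> ?B = {1..i}"
  proof
    show "?A \<union> ?B \<subseteq> {1..i}"
    proof
      fix j assume "j \<in> ?A \<union> ?B"
      then show "j \<in> {1..i}" using code_mono[of i j] i by (cases "j \<le> i") auto
    qed
    show "{1..i} \<subseteq> ?A \<union> ?B"
    proof
      fix j assume "j \<in> {1..i}"
      then show "j \<in> ?A \<union> ?B" using code_mono[of j i] i by auto
    qed
  qed
  then have "i = card (?A \<union> ?B)" by simp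
  also have "\<dots> = card ?A + card ?B" by (rule card_Un_disjoint) auto
  finally show ?thesis using cum_fibres[of "code k \<pi> i"] code_less_max[OF i] by simp
qed

lemma level_fibres:
  assumes i: "i \<in> {1..n}"
  shows "level (fibres n k \<pi>) i = code k \<pi> i"
proof (rule level_eqI)
  let ?u = "code k \<pi> i"
  have "card {j \<in> {1..n}. code k \<pi> j = ?u \<and> j \<le> i} > 0"
    using i by (auto simp: card_gt_0_iff)
  then show "cum (fibres n k \<pi>) ?u < i" using cum_fibres_rank[OF i] by linarith
  have "card {j \<in> {1..n}. code k \<pi> j = ?u \<and> j \<le> i} \<le> card {j \<in> {1..n}. code k \<pi> j = ?u}"
    by (rule card_mono) auto
  also have "\<dots> = fibres n k \<pi> ?u"
    using code_words[OF i] by (simp add: fibres_def)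
  finally show "i \<le> cum (fibres n k \<pi>) (Suc ?u)"
    using cum_fibres_rank[OF i] cum_Suc[of ?u "fibres n k \<pi>"] code_nonzero[OF i] by linarith
qed

text \<open>Since \<open>\<pi>\<close> is increasing on a code class and carries it onto the rotated
  class, it preserves ranks. This is what makes \<open>unfibre\<close> recover
  \<open>\<pi>\<close>.\<close>

lemma image_fibre:
  assumes i: "i \<in> {1..n}"
  shows "\<pi> ` {j \<in> {1..n}. code k \<pi> j = code k \<pi> i \<and> j \<le> i}
       = {j \<in> {1..n}. code k \<pi> j = rot k (code k \<pi> i) \<and> j \<le> \<pi> i}" (is "\<pi> ` ?A = ?B")
proof
  show "\<pi> ` ?A \<subseteq> ?B"
  proof
    fix y assume "y \<in> \<pi> ` ?A"
    then obtain j where j: "y = \<pi> j" "j \<in> {1..n}" "code k \<pi> j = code k \<pi> i" "j \<le> i" by auto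
    then have "\<pi> j \<le> \<pi> i" using less_of_code_eq[of j i] i by (cases "j = i") auto
    then show "y \<in> ?B" using j code_rot[of j] in_range[of j] by simp
  qed
  show "?B \<subseteq> \<pi> ` ?A"
  proof
    fix y assume y: "y \<in> ?B"
    then obtain j where j: "y = \<pi> j" "j \<in> {1..n}"
      using permutes_image[OF perm] by blast
    have "rot k (code k \<pi> j) = rot k (code k \<pi> i)" using y j code_rot[of j] by simp
    then have "code k \<pi> j = code k \<pi> i"
      using inj_on_rot code_words[OF j(2)] code_words[OF i] by (auto dest: inj_onD)
    moreover have "j \<le> i"
      using less_of_code_eq[of i j] i j y calculation by (cases "j \<le> i") auto
    ultimately show "y \<in> \<pi> ` ?A" using j by blast
  qed
qed

lemma unfibre_fibres: "unfibre n k (fibres n k \<pi>) = \<pi>"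
proof
  fix i
  show "unfibre n k (fibres n k \<pi>) i = \<pi> i"
  proof (cases "i \<in> {1..n}")
    case True
    let ?A = "{j \<in> {1..n}. code k \<pi> j = code k \<pi> i \<and> j \<le> i}"
    let ?B = "{j \<in> {1..n}. code k \<pi> j = rot k (code k \<pi> i) \<and> j \<le> \<pi> i}"
    have "card ?B = card ?A"
      unfolding image_fibre[OF True, symmetric]
      by (rule card_image) (rule inj_on_subset[OF permutes_inj[OF perm]], simp)
    moreover have "\<pi> i = cum (fibres n k \<pi>) (rot k (code k \<pi> i)) + card ?B"
      using cum_fibres_rank[OF in_range[OF True]] code_rot[OF True] by simp
    ultimately show ?thesis
      using True cum_fibres_rank[OF True] by (simp add: unfibre_def level_fibres)
  next
    case False
    then show ?thesis using perm by (auto simp: unfibre_def permutes_def)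
  qed
qed

lemma fibres_invariants: "fibres n k \<pi> \<in> invariants n k"
proof -
  have "fibres n k \<pi> (rot k u) = fibres n k \<pi> u" if u: "u \<in> words k" for u
  proof -
    have "bij_betw \<pi> {i \<in> {1..n}. code k \<pi> i = u} {i \<in> {1..n}. code k \<pi> i = rot k u}"
      unfolding bij_betw_def
    proof
      show "inj_on \<pi> {i \<in> {1..n}. code k \<pi> i = u}"
        by (rule inj_on_subset[OF permutes_inj[OF perm]]) simp
      show "\<pi> ` {i \<in> {1..n}. code k \<pi> i = u} = {i \<in> {1..n}. code k \<pi> i = rot k u}"
      proof
        show "{i \<in> {1..n}. code k \<pi> i = rot k u} \<subseteq> \<pi> ` {i \<in> {1..n}. code k \<pi> i = u}"
        proof
          fix y assume y: "y \<in> {i \<in> {1..n}. code k \<pi> i = rot k u}"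
          then obtain j where j: "y = \<pi> j" "j \<in> {1..n}"
            using permutes_image[OF perm] by blast
          then have "rot k (code k \<pi> j) = rot k u" using y code_rot[of j] by simp
          then have "code k \<pi> j = u"
            using inj_on_rot code_words[OF j(2)] u by (auto dest: inj_onD)
          then show "y \<in> \<pi> ` {i \<in> {1..n}. code k \<pi> i = u}" using j by blast
        qed
      qed (use code_rot in_range in auto)
    qed
    then show ?thesis using u rot_words[OF u] by (simp add: fibres_def bij_betw_same_card)
  qed
  moreover have "(\<Sum>u\<in>words k. fibres n k \<pi> u) = n"
  proof -
    have "(\<Sum>u\<in>words k. fibres n k \<pi> u) = cum (fibres n k \<pi>) (2 ^ k - 1)"
      by (simp add: cum_def words_def)
    also have "\<dots> = card {i \<in> {1..n}. code k \<pi> i < 2 ^ k - 1}"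
      by (rule cum_fibres) simp
    also have "{i \<in> {1..n}. code k \<pi> i < 2 ^ k - 1} = {1..n}"
      using code_less_max by blast
    finally show ?thesis by simp
  qed
  ultimately show ?thesis by (auto simp: invariants_def fibres_def)
qed

end

section \<open>From invariant multiplicities to a permutation, and surjectivity\<close>

locale invariant =
  fixes n k :: nat and m :: "nat \<Rightarrow> nat"
  assumes k_pos: "k > 0" and inv: "m \<in> invariants n k"
begin

abbreviation \<pi> :: "nat \<Rightarrow> nat" where "\<pi> \<equiv> unfibre n k m"

lemma m_rot: "u \<in> words k \<Longrightarrow> m (rot k u) = m u"
  using inv by (simp add: invariants_def)

lemma cum_top: "cum m (2 ^ k - 1) = n"
  using inv by (simp add: invariants_def cum_def words_def)

lemma cum_le: "u \<in> words k \<Longrightarrow> cum m u + m u \<le> n"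
  using cum_mono[of "Suc u" "2 ^ k - 1" m] cum_Suc[of u m] cum_top by (simp add: words_def)

lemma level:
  assumes i: "i \<in> {1..n}"
  shows level_words: "level m i \<in> words k"
    and level_lower: "cum m (level m i) < i"
    and level_upper: "i \<le> cum m (level m i) + m (level m i)"
proof -
  define M :: nat where "M = 2 ^ k - 1"
  have "(2::nat) ^ 1 \<le> 2 ^ k" by (rule power_increasing) (use k_pos in auto)
  then have "cum m M = n" "M \<ge> 1" using cum_top by (auto simp: M_def)
  \<comment> \<open>The multiplicities add up to \<open>n\<close>, so \<open>M - 1\<close> is a
    witness for the \<open>LEAST\<close> in \<open>level\<close>.\<close>
  have *: "i \<le> cum m (Suc (M - 1))" using \<open>cum m M = n\<close> \<open>M \<ge> 1\<close> i by simp
  have up: "i \<le> cum m (Suc (level m i))" unfolding level_def by (rule LeastI[of "\<lambda>u. i \<le> cum m (Suc u)", OF *])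
  have "level m i \<le> M - 1" unfolding level_def by (rule Least_le[of "\<lambda>u. i \<le> cum m (Suc u)", OF *])
  moreover have pos: "level m i > 0"
  proof (rule ccontr)
    assume "\<not> level m i > 0"
    then show False using up i by (simp add: cum_def)
  qed
  ultimately show "level m i \<in> words k" using \<open>M \<ge> 1\<close> by (auto simp: words_def M_def)
  show "i \<le> cum m (level m i) + m (level m i)" using up pos by (simp add: cum_Suc)
  have "\<not> i \<le> cum m (Suc (level m i - 1))"
    using not_less_Least[of "level m i - 1" "\<lambda>u. i \<le> cum m (Suc u)"] pos
    by (simp add: level_def)
  then show "cum m (level m i) < i" using pos by simp
qed

lemma level_eq:
  assumes "u \<in> words k" "cum m u < i" "i \<le> cum m u + m u"
  shows "level m i = u"
  by (rule level_eqI) (use assms words_pos in \<open>auto simp: cum_Suc\<close>)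

lemma level_mono:
  assumes "i \<in> {1..n}" "j \<in> {1..n}" "i \<le> j"
  shows "level m i \<le> level m j"
proof (rule ccontr)
  assume "\<not> level m i \<le> level m j"
  then have "cum m (Suc (level m j)) \<le> cum m (level m i)" by (intro cum_mono) simp
  then show False
    using level_lower[OF assms(1)] level_upper[OF assms(2)] words_pos[OF level_words[OF assms(2)]] assms(3)
    by (simp add: cum_Suc)
qed

lemma perm_eq: "i \<in> {1..n} \<Longrightarrow> \<pi> i = cum m (rot k (level m i)) + (i - cum m (level m i))"
  by (simp add: unfibre_def)

lemma perm_bounds:
  assumes i: "i \<in> {1..n}"
  shows "cum m (rot k (level m i)) < \<pi> i"
    and "\<pi> i \<le> cum m (rot k (level m i)) + m (rot k (level m i))"
  using level_lower[OF i] level_upper[OF i] perm_eq[OF i] m_rot[OF level_words[OF i]] by auto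

lemma perm_in_range:
  assumes i: "i \<in> {1..n}"
  shows "\<pi> i \<in> {1..n}"
  using perm_bounds[OF i] cum_le[OF rot_words[OF level_words[OF i]]] by auto

lemma level_perm: "i \<in> {1..n} \<Longrightarrow> level m (\<pi> i) = rot k (level m i)"
  by (rule level_eq) (use perm_bounds rot_words level_words in auto)

text \<open>The offset inside the level never changes along an orbit, because a level and its
  rotation have equal size. Only the level rotates, and it returns after \<open>k\<close>
  steps.\<close>

lemma funpow_perm:
  assumes i: "i \<in> {1..n}"
  shows "(\<pi> ^^ t) i \<in> {1..n} \<and> level m ((\<pi> ^^ t) i) = (rot k ^^ t) (level m i) \<and>
    (\<pi> ^^ t) i = cum m ((rot k ^^ t) (level m i)) + (i - cum m (level m i))"
proof (induction t)
  case 0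
  then show ?case using i level_lower[OF i] by simp
next
  case (Suc t)
  let ?x = "(\<pi> ^^ t) i"
  have x: "?x \<in> {1..n}" and lv: "level m ?x = (rot k ^^ t) (level m i)"
    and eq: "?x = cum m ((rot k ^^ t) (level m i)) + (i - cum m (level m i))"
    using Suc by blast+
  have "\<pi> ?x = cum m (rot k (level m ?x)) + (?x - cum m (level m ?x))"
    by (rule perm_eq[OF x])
  also have "?x - cum m (level m ?x) = i - cum m (level m i)"
    unfolding lv using eq by linarith
  finally show ?case using perm_in_range[OF x] level_perm[OF x] lv by simp
qed

lemma perm_power: "\<pi> ^^ k = id"
proof
  fix i
  show "(\<pi> ^^ k) i = id i"
  proof (cases "i \<in> {1..n}")
    case True
    then show ?thesis
      using funpow_perm[OF True, of k] level_lower[OF True]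
      by (simp add: funpow_rot_period level_words)
  next
    case False
    then have "(\<pi> ^^ t) i = i" for t by (induction t) (auto simp: unfibre_def)
    then show ?thesis by simp
  qed
qed

text \<open>Bijectivity comes from \<open>perm_power\<close>: the power with exponent
  \<open>k - 1\<close> is a two-sided inverse.\<close>

lemma perm_permutes: "\<pi> permutes {1..n}"
proof -
  obtain t where t: "k = Suc t" using k_pos by (cases k) auto
  have "(\<pi> ^^ t) \<circ> \<pi> = id" "\<pi> \<circ> (\<pi> ^^ t) = id"
    using perm_power t by (metis funpow_Suc_right, metis funpow.simps(2))
  then have "bij \<pi>" using o_bij by blast
  then show ?thesis unfolding permutes_def bij_iff by (simp add: unfibre_def)
qed

text \<open>Levels are weakly increasing and no word is fixed by \<open>rot\<close>, so comparing
  \<open>\<pi> i\<close> with \<open>i\<close> amounts to comparing their levels.\<close>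

lemma perm_less_iff:
  assumes i: "i \<in> {1..n}"
  shows "\<pi> i < i \<longleftrightarrow> 2 ^ (k - 1) \<le> level m i" and "\<pi> i \<noteq> i"
proof -
  have neq: "rot k (level m i) \<noteq> level m i" by (rule rot_neq[OF level_words[OF i]])
  then show "\<pi> i \<noteq> i" using level_perm[OF i] by metis
  have "\<pi> i < i \<longleftrightarrow> rot k (level m i) < level m i"
    using level_mono[OF i perm_in_range[OF i]] level_mono[OF perm_in_range[OF i] i] level_perm[OF i] neq
    by linarith
  then show "\<pi> i < i \<longleftrightarrow> 2 ^ (k - 1) \<le> level m i"
    using rot_less_iff[OF level_words[OF i]] by simp
qed

text \<open>Within one level the offsets decide. Across levels, \<open>rot_strict_mono\<close> keeps
  the target levels in order, and these occupy disjoint intervals.\<close>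

lemma perm_less:
  assumes "i \<in> {1..n}" "j \<in> {1..n}" "i < j"
    and same: "level m i < 2 ^ (k - 1) \<longleftrightarrow> level m j < 2 ^ (k - 1)"
  shows "\<pi> i < \<pi> j"
proof (cases "level m i = level m j")
  case True
  then show ?thesis
    using perm_eq[OF assms(1)] perm_eq[OF assms(2)] level_lower[OF assms(1)] assms(3) by simp
next
  case False
  then have "level m i < level m j" using level_mono[OF assms(1,2)] assms(3) by simp
  then have "rot k (level m i) < rot k (level m j)"
    using rot_strict_mono level_words assms(1,2) same by blast
  then have "cum m (Suc (rot k (level m i))) \<le> cum m (rot k (level m j))"
    by (intro cum_mono) simp
  then show ?thesis
    using perm_bounds(2)[OF assms(1)] perm_bounds(1)[OF assms(2)]
      words_pos[OF rot_words[OF level_words[OF assms(1)]]] by (simp add: cum_Suc)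
qed

text \<open>By \<open>perm_less\<close> a descent needs a change of leading bit, and monotone levels
  allow only one change, from 0 to 1.\<close>

lemma des_perm: "des n \<pi> \<le> 1"
proof -
  let ?S = "{i \<in> {1..<n}. \<pi> i > \<pi> (i + 1)}"
  have cut: "level m i < 2 ^ (k - 1)" "2 ^ (k - 1) \<le> level m (Suc i)" if "i \<in> ?S" for i
    using that perm_less[of i "Suc i"] level_mono[of i "Suc i"] by fastforce+
  have "\<not> i < j" if "i \<in> ?S" "j \<in> ?S" for i j
    using cut(2)[OF that(1)] cut(1)[OF that(2)] level_mono[of "Suc i" j] that by fastforce
  then have "i = j" if "i \<in> ?S" "j \<in> ?S" for i j
    using that by (meson linorder_neqE_nat)
  then show ?thesis unfolding des_def by (simp add: card_le_Suc0_iff_eq)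
qed

lemma unfibre_roots: "n \<ge> 1 \<Longrightarrow> \<pi> \<in> grassmannian_roots n k"
  using perm_permutes des_perm perm_power perm_less_iff(2)[of 1] perm_less_iff(2)[of n]
  by (simp add: grassmannian_roots_def grassmannian_def)

text \<open>This is binary long division of the level by \<open>2 ^ k - 1\<close>: the rotations are
  the remainders, the bits of the code are the quotient digits, and the remainder recurs after
  \<open>k\<close> digits.\<close>

lemma code_perm:
  assumes i: "i \<in> {1..n}"
  shows "code k \<pi> i = level m i"
proof -
  \<comment> \<open>\<open>C t\<close> is the quotient formed by the first \<open>t\<close>
    digits.\<close>
  define C where "C t = (\<Sum>j<t. of_bool ((\<pi> ^^ Suc j) i < (\<pi> ^^ j) i) * 2 ^ (t - 1 - j) :: int)" for t
  have "int ((rot k ^^ t) (level m i)) + (2 ^ k - 1) * C t = 2 ^ t * int (level m i)" for t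
  proof (induction t)
    case (Suc t)
    let ?x = "(\<pi> ^^ t) i"
    have x: "?x \<in> {1..n}" "level m ?x = (rot k ^^ t) (level m i)" using funpow_perm[OF i, of t] by blast+
    have "C (Suc t) = 2 * C t + of_bool (\<pi> ?x < ?x)"
    proof -
      have "(\<Sum>j<t. of_bool ((\<pi> ^^ Suc j) i < (\<pi> ^^ j) i) * (2::int) ^ (t - j)) = 2 * C t"
        unfolding C_def sum_distrib_left
      proof (rule sum.cong)
        fix j assume "j \<in> {..<t}"
        then have "t - j = Suc (t - 1 - j)" by simp
        then show "of_bool ((\<pi> ^^ Suc j) i < (\<pi> ^^ j) i) * (2::int) ^ (t - j)
          = 2 * (of_bool ((\<pi> ^^ Suc j) i < (\<pi> ^^ j) i) * 2 ^ (t - 1 - j))" by simp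
      qed simp
      then show ?thesis by (simp add: C_def)
    qed
    moreover have "int ((rot k ^^ Suc t) (level m i))
        = 2 * int ((rot k ^^ t) (level m i)) - of_bool (\<pi> ?x < ?x) * (2 ^ k - 1)"
      using int_rot[OF level_words[OF x(1)]] perm_less_iff(1)[OF x(1)] x(2) by simp
    ultimately show ?case using Suc by (simp add: algebra_simps)
  qed (simp add: C_def)
  from this[of k] have "(2 ^ k - 1) * C k = (2 ^ k - 1) * int (level m i)"
    by (simp add: funpow_rot_period[OF level_words[OF i]] algebra_simps)
  moreover have "(2::int) ^ k - 1 \<noteq> 0" using k_pos by simp
  ultimately have "C k = int (level m i)" by simp
  moreover have "C k = int (code k \<pi> i)" by (simp add: C_def code_def)
  ultimately show ?thesis by simp
qed

lemma fibres_unfibre: "fibres n k \<pi> = m"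
proof
  fix u
  show "fibres n k \<pi> u = m u"
  proof (cases "u \<in> words k")
    case True
    have "{i \<in> {1..n}. code k \<pi> i = u} = {i \<in> {1..n}. level m i = u}"
      using code_perm by auto
    also have "\<dots> = {cum m u<..cum m u + m u}"
    proof
      show "{i \<in> {1..n}. level m i = u} \<subseteq> {cum m u<..cum m u + m u}"
        using level_lower level_upper by force
      show "{cum m u<..cum m u + m u} \<subseteq> {i \<in> {1..n}. level m i = u}"
        using level_eq[OF True] cum_le[OF True] by auto
    qed
    finally show ?thesis using True by (simp add: fibres_def)
  next
    case False
    then show ?thesis using inv by (auto simp: fibres_def invariants_def PiE_def extensional_def)
  qed
qed

end

lemma card_grassmannian_roots_eq_invariants:
  assumes "n \<ge> 1" "k > 0"
  shows "card (grassmannian_roots n k) = card (invariants n k)"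
proof (rule bij_betw_same_card, rule bij_betw_byWitness[where f = "fibres n k" and f' = "unfibre n k"])
  show "\<forall>\<pi>\<in>grassmannian_roots n k. unfibre n k (fibres n k \<pi>) = \<pi>"
    using assms grassmannian_roots_imp_perm_root perm_root.unfibre_fibres by blast
  show "\<forall>m\<in>invariants n k. fibres n k (unfibre n k m) = m"
    using assms by (auto intro: invariant.fibres_unfibre invariant.intro)
  show "fibres n k ` grassmannian_roots n k \<subseteq> invariants n k"
    using assms grassmannian_roots_imp_perm_root perm_root.fibres_invariants by blast
  show "unfibre n k ` invariants n k \<subseteq> grassmannian_roots n k"
    using assms by (auto intro: invariant.unfibre_roots invariant.intro)
qed

section \<open>Counting rotation orbits\<close>

text \<open>Only forward iterates are taken; at a periodic point they already form the whole
  cycle.\<close>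

definition orb :: "('a \<Rightarrow> 'a) \<Rightarrow> 'a \<Rightarrow> 'a set" where
  "orb f x = range (\<lambda>j. (f ^^ j) x)"

lemma orb_self: "x \<in> orb f x"
  unfolding orb_def by (rule range_eqI[of _ _ 0]) simp

lemma orb_step: "f x \<in> orb f x"
  unfolding orb_def by (rule range_eqI[of _ _ 1]) simp

lemma funpow_funpow: "(f ^^ a) ((f ^^ b) x) = (f ^^ (a + b)) x"
  by (simp add: funpow_add)

lemma orb_eq:
  assumes "(f ^^ k) x = x" "k > 0" "y \<in> orb f x"
  shows "orb f y = orb f x"
proof -
  obtain j where j: "y = (f ^^ j) x" using assms(3) by (auto simp: orb_def)
  \<comment> \<open>\<open>k * j\<close> is a multiple of the period and at least \<open>j\<close>,
    so \<open>k * j - j\<close> further steps lead from \<open>y\<close> back to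
    \<open>x\<close>.\<close>
  have "j \<le> k * j" using assms(2) by simp
  then have "(f ^^ (k * j - j)) y = (f ^^ (k * j)) x"
    by (simp only: j funpow_funpow le_add_diff_inverse2)
  also have "\<dots> = x" using funpow_mod_eq[OF assms(1), of "k * j"] by simp
  finally have x: "(f ^^ (k * j - j)) y = x" .
  have sub: "orb f ((f ^^ t) z) \<subseteq> orb f z" for t z
    unfolding orb_def by (auto simp: funpow_funpow)
  show ?thesis
  proof
    show "orb f y \<subseteq> orb f x" unfolding j by (rule sub)
    show "orb f x \<subseteq> orb f y" using sub[of "k * j - j" y] unfolding x .
  qed
qed

lemma card_orb:
  assumes "(f ^^ k) x = x" "k > 0"
  shows "card (orb f x) = least_power f x"
proof -
  let ?p = "least_power f x"
  have p: "(f ^^ ?p) x = x" "?p > 0" using least_powerI[OF assms] by auto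
  have "orb f x = (\<lambda>j. (f ^^ j) x) ` {..<?p}"
  proof
    show "orb f x \<subseteq> (\<lambda>j. (f ^^ j) x) ` {..<?p}"
      unfolding orb_def
    proof
      fix y assume "y \<in> range (\<lambda>j. (f ^^ j) x)"
      then obtain j where "y = (f ^^ j) x" by auto
      then have "y = (f ^^ (j mod ?p)) x" by (simp add: funpow_mod_eq[OF p(1)])
      then show "y \<in> (\<lambda>j. (f ^^ j) x) ` {..<?p}" using p(2) by auto
    qed
  qed (auto simp: orb_def)
  moreover have "inj_on (\<lambda>j. (f ^^ j) x) {..<?p}"
  proof (rule linorder_inj_onI)
    fix i j assume ij: "i < j" "i \<in> {..<?p}" "j \<in> {..<?p}"
    show "(f ^^ i) x \<noteq> (f ^^ j) x"
    proof
      assume eq: "(f ^^ i) x = (f ^^ j) x"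
      \<comment> \<open>Applying \<open>?p - i\<close> further steps to both iterates closes the
        first one up and leaves \<open>j - i\<close> as a period below the least one.\<close>
      have "(f ^^ (?p - i)) ((f ^^ i) x) = x"
        unfolding funpow_funpow using p(1) ij by simp
      moreover have "(f ^^ (?p - i)) ((f ^^ j) x) = (f ^^ (j - i)) ((f ^^ ?p) x)"
        unfolding funpow_funpow using ij by (intro arg_cong[of _ _ "\<lambda>t. (f ^^ t) x"]) simp
      ultimately have "(f ^^ (j - i)) x = x" unfolding eq p(1) by simp
      then have "?p \<le> j - i" using ij by (intro least_power_le) auto
      then show False using ij by auto
    qed
  qed auto
  ultimately show ?thesis by (simp add: card_image)
qed

lemma funpow_fixed_iff_card_orb:
  assumes "(f ^^ k) x = x" "k > 0"
  shows "(f ^^ t) x = x \<longleftrightarrow> card (orb f x) dvd t"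
proof
  assume "card (orb f x) dvd t"
  then have "t mod least_power f x = 0" by (simp add: card_orb[OF assms])
  then show "(f ^^ t) x = x"
    using funpow_mod_eq[OF least_powerI(1)[OF assms], of t] by simp
qed (simp add: card_orb[OF assms] least_power_minimal)

text \<open>For a divisor \<open>d > 1\<close> of \<open>k\<close> these correspond to the primitive
  binary necklaces of length \<open>d\<close>, each written out \<open>k div d\<close>
  times.\<close>

definition necklaces :: "nat \<Rightarrow> nat \<Rightarrow> nat set set" where
  "necklaces k d = {c \<in> orb (rot k) ` words k. card c = d}"

lemma finite_necklaces [simp]: "finite (necklaces k d)"
  by (simp add: necklaces_def)

lemma orb_words: "u \<in> words k \<Longrightarrow> orb (rot k) u \<subseteq> words k"
  by (auto simp: orb_def intro: funpow_rot_words)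

lemma orb_rot_eq: "u \<in> words k \<Longrightarrow> w \<in> orb (rot k) u \<Longrightarrow> orb (rot k) w = orb (rot k) u"
  by (rule orb_eq[OF funpow_rot_period]) (simp_all add: words_imp_pow)

lemma card_words_orb:
  assumes "k > 0"
  shows "card {u \<in> words k. card (orb (rot k) u) = d} = d * card (necklaces k d)"
proof -
  have Un: "\<Union> (necklaces k d) = {u \<in> words k. card (orb (rot k) u) = d}"
  proof
    show "\<Union> (necklaces k d) \<subseteq> {u \<in> words k. card (orb (rot k) u) = d}"
    proof
      fix w assume "w \<in> \<Union> (necklaces k d)"
      then obtain u where u: "u \<in> words k" "w \<in> orb (rot k) u" "card (orb (rot k) u) = d"
        by (auto simp: necklaces_def)
      then show "w \<in> {u \<in> words k. card (orb (rot k) u) = d}"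
        using orb_words[OF u(1)] orb_rot_eq[OF u(1,2)] by auto
    qed
    show "{u \<in> words k. card (orb (rot k) u) = d} \<subseteq> \<Union> (necklaces k d)"
      using orb_self[of _ "rot k"] by (auto simp: necklaces_def)
  qed
  have "d * card (necklaces k d) = card (\<Union> (necklaces k d))"
  proof (rule card_partition)
    show "finite (\<Union> (necklaces k d))" unfolding Un by simp
    fix c c' assume c: "c \<in> necklaces k d" "c' \<in> necklaces k d" "c \<noteq> c'"
    then obtain u w where uw: "u \<in> words k" "w \<in> words k" "c = orb (rot k) u" "c' = orb (rot k) w"
      by (auto simp: necklaces_def)
    show "c \<inter> c' = {}"
    proof (rule ccontr)
      assume "c \<inter> c' \<noteq> {}"
      then obtain v where "v \<in> orb (rot k) u" "v \<in> orb (rot k) w" using uw by blast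
      then have "c = c'"
        using orb_rot_eq[OF uw(1), of v] orb_rot_eq[OF uw(2), of v] uw(3,4) by metis
      then show False using c(3) by simp
    qed
  qed (auto simp: necklaces_def)
  then show ?thesis by (simp add: Un)
qed

text \<open>A word is fixed by \<open>d\<close> rotations exactly if its orbit size divides
  \<open>d\<close>, so the sum sorts the words counted by \<open>card_fixed_rot\<close> by orbit
  size.\<close>

lemma sum_card_words_orb:
  assumes "d dvd k" "k > 0"
  shows "(\<Sum>e | e dvd d. card {u \<in> words k. card (orb (rot k) u) = e}) = 2 ^ d - 2"
proof -
  have "d > 0" using assms by (auto intro: Nat.gr0I)
  then have "(\<Sum>e | e dvd d. card {u \<in> words k. card (orb (rot k) u) = e})
      = card (\<Union>e\<in>{e. e dvd d}. {u \<in> words k. card (orb (rot k) u) = e})"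
    by (intro card_UN_disjoint[symmetric]) (simp_all, blast)
  also have "(\<Union>e\<in>{e. e dvd d}. {u \<in> words k. card (orb (rot k) u) = e})
      = {u \<in> words k. (rot k ^^ d) u = u}"
  proof -
    have "(rot k ^^ d) u = u \<longleftrightarrow> card (orb (rot k) u) dvd d" if "u \<in> words k" for u
      by (rule funpow_fixed_iff_card_orb[OF funpow_rot_period[OF that] assms(2)])
    then show ?thesis by blast
  qed
  also have "card \<dots> = 2 ^ d - 2" by (rule card_fixed_rot[OF assms])
  finally show ?thesis .
qed

text \<open>The number of words of each orbit size is found by Moebius inversion; division by
  \<open>d\<close> passes from words to orbits. In particular the rational \<open>N d\<close> is a
  natural number.\<close>

lemma N_eq_card_necklaces:
  assumes "d dvd k" "k > 0"
  shows "N d = of_nat (card (necklaces k d))"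
proof -
  have d: "d > 0" using assms by (auto intro: Nat.gr0I)
  let ?f = "\<lambda>e. rat_of_nat (card {u \<in> words k. card (orb (rot k) u) = e})"
  have "?f d = (\<Sum>e | e dvd d. of_int (moebius e) * (2 ^ (d div e) - 2))"
  proof (rule moebius_inversion[OF d])
    fix e assume e: "e dvd d"
    then have "e > 0" using d by (auto intro: Nat.gr0I)
    then have "(2::nat) ^ 1 \<le> 2 ^ e" by (intro power_increasing) auto
    moreover have "(\<Sum>c | c dvd e. ?f c) = rat_of_nat (2 ^ e - 2)"
      using sum_card_words_orb[OF dvd_trans[OF e assms(1)] assms(2)] by (simp flip: of_nat_sum)
    ultimately show "2 ^ e - 2 = (\<Sum>c | c dvd e. ?f c)" by (simp add: of_nat_diff)
  qed
  also have "\<dots> = of_nat d * N d" by (rule N_eq_moebius_sum[OF d, symmetric])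
  finally show ?thesis using d by (simp add: card_words_orb[OF assms(2)])
qed

section \<open>Rotation orbits as the variables of the linear equation\<close>

lemma var_range_eq:
  assumes "d dvd k" "k > 0"
  shows "var_range d = {1..card (necklaces k d)}"
  unfolding var_range_def N_eq_card_necklaces[OF assms] of_nat_le_iff by auto

lemma D_dvd: "d \<in> D k \<Longrightarrow> d dvd k"
  by (simp add: D_def)

lemma finite_D: "k > 0 \<Longrightarrow> finite (D k)"
  by (rule finite_subset[of _ "{d. d dvd k}"]) (auto simp: D_def)

text \<open>An invariant function is constant on orbits. Its value on the \<open>i\<close>-th orbit
  of size \<open>d\<close> becomes the variable with index \<open>(d, i)\<close>, and the
  \<open>d\<close> words in the orbit account for the coefficient \<open>d\<close>.\<close>

lemma card_invariants_eq_solutions: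
  assumes k: "k > 0"
  shows "card (invariants n k) = card (solutions n k)"
proof -
  define Idx where "Idx = (SIGMA d:D k. var_range d)"
  have fin_var: "finite (var_range d)" if "d \<in> D k" for d
    using var_range_eq[OF D_dvd[OF that] k] by simp
  have fin: "finite Idx" unfolding Idx_def using finite_D[OF k] fin_var by auto
  have "\<exists>b. bij_betw b (necklaces k d) (var_range d)" if "d \<in> D k" for d
    using var_range_eq[OF D_dvd[OF that] k] by (intro finite_same_card_bij) auto
  then obtain b where b: "bij_betw (b d) (necklaces k d) (var_range d)" if "d \<in> D k" for d
    by metis
  \<comment> \<open>\<open>q\<close> sends a word to the index of its orbit: the size, and the
    number that \<open>b\<close> assigns to the orbit among those of that size.\<close>
  define q where "q u = (card (orb (rot k) u), b (card (orb (rot k) u)) (orb (rot k) u))" for u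
  have card_D: "card (orb (rot k) u) \<in> D k" if u: "u \<in> words k" for u
  proof -
    have "card (orb (rot k) u) dvd k"
      using funpow_fixed_iff_card_orb[OF funpow_rot_period[OF u] k] funpow_rot_period[OF u] by blast
    \<comment> \<open>Since \<open>rot\<close> fixes no word, orbits of size 1 do not occur, in
      accordance with the exclusion of 1 from \<open>D k\<close>.\<close>
    moreover have "card (orb (rot k) u) \<noteq> 1"
    proof
      assume "card (orb (rot k) u) = 1"
      then obtain v where "orb (rot k) u = {v}" by (rule card_1_singletonE)
      then show False using orb_self[of u "rot k"] orb_step[of "rot k" u] rot_neq[OF u] by simp
    qed
    ultimately show ?thesis by (simp add: D_def)
  qed
  have orb_neck: "orb (rot k) u \<in> necklaces k (card (orb (rot k) u))" if "u \<in> words k" for u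
    using that by (simp add: necklaces_def)
  have q_Idx: "q u \<in> Idx" if "u \<in> words k" for u
    using bij_betwE[OF b[OF card_D[OF that]]] orb_neck[OF that] card_D[OF that]
    by (auto simp: q_def Idx_def)
  have q_eq: "q u = q w \<longleftrightarrow> orb (rot k) u = orb (rot k) w" if "u \<in> words k" "w \<in> words k" for u w
  proof
    assume eq: "q u = q w"
    then have c: "card (orb (rot k) u) = card (orb (rot k) w)" by (simp add: q_def)
    show "orb (rot k) u = orb (rot k) w"
    proof (rule inj_onD[OF bij_betw_imp_inj_on[OF b[OF card_D[OF that(1)]]]])
      show "orb (rot k) w \<in> necklaces k (card (orb (rot k) u))"
        unfolding c by (rule orb_neck[OF that(2)])
    qed (use eq c orb_neck[OF that(1)] in \<open>auto simp: q_def\<close>)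
  qed (simp add: q_def)
  have q_rot: "q (rot k u) = q u" if "u \<in> words k" for u
    using orb_rot_eq[OF that orb_step] by (simp add: q_def)
  have q_fibre: "card {u \<in> words k. q u = p} = fst p \<and> (\<exists>u\<in>words k. q u = p)" if p: "p \<in> Idx" for p
  proof -
    obtain d i where di: "p = (d, i)" "d \<in> D k" "i \<in> var_range d" using p by (auto simp: Idx_def)
    have "i \<in> b d ` necklaces k d" using b[OF di(2)] di(3) by (simp add: bij_betw_def)
    then obtain u where u: "u \<in> words k" "card (orb (rot k) u) = d" "i = b d (orb (rot k) u)"
      by (auto simp: necklaces_def)
    then have qu: "q u = p" by (simp add: q_def di)
    have "q w = q u \<longleftrightarrow> w \<in> orb (rot k) u" if "w \<in> words k" for w
      using q_eq[OF that u(1)] orb_self[of w "rot k"] orb_rot_eq[OF u(1), of w] by auto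
    then have "{w \<in> words k. q w = q u} = orb (rot k) u"
      using orb_words[OF u(1)] by blast
    then have "card {w \<in> words k. q w = p} = fst p" unfolding qu by (simp add: u(2) di(1))
    then show ?thesis using u(1) qu by blast
  qed
  have inv_const: "m u = m w"
    if m: "m \<in> invariants n k" and uw: "u \<in> words k" "w \<in> words k" "q u = q w" for m u w
  proof -
    have "w \<in> orb (rot k) u" using q_eq[OF uw(1,2)] uw(3) orb_self[of w "rot k"] by simp
    then obtain j where "w = (rot k ^^ j) u" by (auto simp: orb_def)
    moreover have "m ((rot k ^^ j) u) = m u" for j
      by (induction j) (use m funpow_rot_words[OF uw(1)] in \<open>auto simp: invariants_def\<close>)
    ultimately show ?thesis by simp
  qed
  have sum_q: "(\<Sum>u\<in>words k. x (q u)) = (\<Sum>d\<in>D k. d * (\<Sum>i\<in>var_range d. x (d, i)))" for x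
  proof -
    have "(\<Sum>u\<in>words k. x (q u)) = (\<Sum>p\<in>Idx. \<Sum>u\<in>{u \<in> words k. q u = p}. x (q u))"
      by (rule sum.group[symmetric]) (use fin q_Idx in auto)
    also have "\<dots> = (\<Sum>p\<in>Idx. fst p * x p)"
      by (rule sum.cong) (use q_fibre in auto)
    also have "\<dots> = (\<Sum>d\<in>D k. \<Sum>i\<in>var_range d. d * x (d, i))"
      unfolding Idx_def using finite_D[OF k] fin_var
      by (subst sum.Sigma) (auto simp: case_prod_unfold)
    finally show ?thesis by (simp add: sum_distrib_left)
  qed
  \<comment> \<open>\<open>s\<close> chooses a representative word in each orbit. Evaluation at
    representatives (\<open>?F\<close>) and pullback along \<open>q\<close> (\<open>?G\<close>) are
    mutually inverse.\<close>
  define s where "s p = (SOME u. u \<in> words k \<and> q u = p)" for p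
  have s: "s p \<in> words k" "q (s p) = p" if "p \<in> Idx" for p
    using someI_ex[of "\<lambda>u. u \<in> words k \<and> q u = p"] q_fibre[OF that] by (auto simp: s_def)
  let ?F = "\<lambda>m :: nat \<Rightarrow> nat. restrict (\<lambda>p. m (s p)) Idx"
  let ?G = "\<lambda>x :: nat \<times> nat \<Rightarrow> nat. restrict (\<lambda>u. x (q u)) (words k)"
  have FG: "?F (?G x) = x" if "x \<in> Idx \<rightarrow>\<^sub>E UNIV" for x
    using that s by (intro ext) (auto simp: PiE_def extensional_def)
  have GF: "?G (?F m) = m" if "m \<in> invariants n k" for m
  proof
    fix u
    show "?G (?F m) u = m u"
    proof (cases "u \<in> words k")
      case True
      then show ?thesis using inv_const[OF that s(1)[OF q_Idx] _ s(2)[OF q_Idx]] q_Idx by simp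
    next
      case False
      then show ?thesis using that by (auto simp: invariants_def PiE_def extensional_def)
    qed
  qed
  have "bij_betw ?F (invariants n k) (solutions n k)"
  proof (rule bij_betw_byWitness[where f' = ?G])
    show "\<forall>m\<in>invariants n k. ?G (?F m) = m" using GF by blast
    show "\<forall>x\<in>solutions n k. ?F (?G x) = x" using FG by (auto simp: solutions_def Idx_def)
    show "?F ` invariants n k \<subseteq> solutions n k"
    proof
      fix x assume "x \<in> ?F ` invariants n k"
      then obtain m where m: "m \<in> invariants n k" "x = ?F m" by auto
      have "(\<Sum>u\<in>words k. x (q u)) = (\<Sum>u\<in>words k. ?G x u)" by simp
      also have "\<dots> = n" using m GF[OF m(1)] by (simp add: invariants_def)
      finally have "(\<Sum>d\<in>D k. d * (\<Sum>i\<in>var_range d. x (d, i))) = n" unfolding sum_q .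
      moreover have "x \<in> Idx \<rightarrow>\<^sub>E UNIV" using m by simp
      ultimately show "x \<in> solutions n k" by (simp add: solutions_def Idx_def)
    qed
    show "?G ` solutions n k \<subseteq> invariants n k"
    proof
      fix m assume "m \<in> ?G ` solutions n k"
      then obtain x where x: "x \<in> solutions n k" "m = ?G x" by auto
      have "(\<Sum>u\<in>words k. m u) = (\<Sum>u\<in>words k. x (q u))" unfolding x(2) by simp
      also have "\<dots> = n" unfolding sum_q using x(1) by (simp add: solutions_def)
      finally show "m \<in> invariants n k" by (simp add: invariants_def x(2) q_rot rot_words)
    qed
  qed
  then show ?thesis by (rule bij_betw_same_card)
qed

text \<open>The equation reduces to \<open>M\<close> non-negative integers with sum
  \<open>n div p\<close>, which are counted by stars and bars.\<close>

lemma card_solutions_prime: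
  assumes p: "prime p" and var: "var_range p = {1..M}" and M: "M \<ge> 1"
  shows "card (solutions n p) = (if p dvd n then (n div p + M - 1) choose (M - 1) else 0)"
proof -
  have pos: "p > 0" using p by (rule prime_gt_0_nat)
  have Dp: "D p = {p}" using p by (auto simp: D_def prime_nat_iff)
  have Sig: "(SIGMA d:{p}. var_range d) = {p} \<times> {1..M}" using var by auto
  have sol: "solutions n p = {x \<in> {p} \<times> {1..M} \<rightarrow>\<^sub>E UNIV. p * (\<Sum>i=1..M. x (p, i)) = n}"
    using Sig by (simp add: solutions_def Dp var)
  show ?thesis
  proof (cases "p dvd n")
    case False
    then have "solutions n p = {}" by (auto simp: sol)
    then show ?thesis using False by simp
  next
    case True
    let ?L = "{l :: nat list. length l = M \<and> sum_list l = n div p}"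
    \<comment> \<open>The variables are numbered from 1 and list positions from 0, hence the
      \<open>Suc\<close> here and the \<open>i - 1\<close> in \<open>?G\<close>.\<close>
    let ?F = "\<lambda>x. map (\<lambda>i. x (p, Suc i)) [0..<M]"
    let ?G = "\<lambda>l. restrict (\<lambda>(d, i). l ! (i - 1)) ({p} \<times> {1..M})"
    have sum_eq: "p * s = n \<longleftrightarrow> s = n div p" for s using True pos by auto
    have shift: "(\<Sum>i=Suc 0..M. f i) = (\<Sum>i<M. f (Suc i))" for f :: "nat \<Rightarrow> nat"
      by (rule sum.reindex_bij_witness[of _ Suc "\<lambda>i. i - 1"]) auto
    have "bij_betw ?F (solutions n p) ?L"
    proof (rule bij_betw_byWitness[where f' = ?G])
      show "\<forall>x\<in>solutions n p. ?G (?F x) = x"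
      proof
        fix x assume "x \<in> solutions n p"
        then have "x \<in> extensional ({p} \<times> {1..M})" by (auto simp: sol PiE_def)
        then show "?G (?F x) = x"
          by (intro extensionalityI[of _ "{p} \<times> {1..M}"]) auto
      qed
      show "\<forall>l\<in>?L. ?F (?G l) = l" by (auto intro: nth_equalityI)
      show "?F ` solutions n p \<subseteq> ?L"
        by (auto simp: sol sum_eq shift sum_list_sum_nth atLeast0LessThan)
      show "?G ` ?L \<subseteq> solutions n p"
      proof
        fix x assume "x \<in> ?G ` ?L"
        then obtain l where l: "x = ?G l" "length l = M" "sum_list l = n div p" by auto
        have "x \<in> {p} \<times> {1..M} \<rightarrow>\<^sub>E UNIV" unfolding l(1) by simp
        moreover have "(\<Sum>i=1..M. x (p, i)) = n div p"
          using l by (simp add: shift sum_list_sum_nth atLeast0LessThan)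
        ultimately show "x \<in> solutions n p" by (simp add: sol sum_eq)
      qed
    qed
    then have "card (solutions n p) = (n div p + M - 1) choose (n div p)"
      by (simp add: bij_betw_same_card card_length_sum_list)
    also have "\<dots> = (n div p + M - 1) choose (M - 1)"
      using M by (subst binomial_symmetric) auto
    finally show ?thesis using True by simp
  qed
qed

theorem theorem1p4:
  fixes n k :: nat
  assumes "k \<ge> 2" and "n \<ge> 1"
  shows "card (grassmannian_roots n k) = card (solutions n k) \<and>
    (\<forall>p::nat. prime p \<longrightarrow>
      N p = (1 / of_nat p) * (2 ^ p - 2) \<and>
      (\<exists>M::nat. M \<ge> 1 \<and> N p = of_nat M \<and>
        card (grassmannian_roots n p) =
          (if p dvd n then (n div p + M - 1) choose (M - 1) else 0)))"
proof (intro conjI allI impI)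
  have eq: "card (grassmannian_roots n j) = card (solutions n j)" if "j > 0" for j
    using card_grassmannian_roots_eq_invariants card_invariants_eq_solutions assms(2) that by simp
  then show "card (grassmannian_roots n k) = card (solutions n k)" using assms(1) by simp
  fix p :: nat assume p: "prime p"
  show Np: "N p = (1 / of_nat p) * (2 ^ p - 2)" by (rule N_prime[OF p])
  \<comment> \<open>The natural number behind \<open>N p\<close> is the number of rotation orbits of
    size \<open>p\<close> on the \<open>p\<close>-bit words.\<close>
  let ?M = "card (necklaces p p)"
  have pos: "p > 0" using p by (rule prime_gt_0_nat)
  have NM: "N p = of_nat ?M" by (rule N_eq_card_necklaces) (use pos in auto)
  \<comment> \<open>From \<open>2 ^ p \<ge> 4\<close> it follows that \<open>N p\<close> is
    positive, so \<open>?M - 1\<close> is not truncated.\<close>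
  have "(2::rat) ^ 2 \<le> 2 ^ p" by (rule power_increasing) (use prime_ge_2_nat[OF p] in auto)
  then have "N p > 0" using pos by (simp add: Np)
  then have "?M \<ge> 1" using NM by simp
  then have "card (grassmannian_roots n p) =
      (if p dvd n then (n div p + ?M - 1) choose (?M - 1) else 0)"
    unfolding eq[OF pos] by (rule card_solutions_prime[OF p var_range_eq[OF dvd_refl pos]])
  then show "\<exists>M::nat. M \<ge> 1 \<and> N p = of_nat M \<and> card (grassmannian_roots n p) =
      (if p dvd n then (n div p + M - 1) choose (M - 1) else 0)"
    using NM \<open>?M \<ge> 1\<close> by blast
qed

end
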